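(* Let $q,x$ be independent formal variables. Then \[ \sum_{n\geq 0} \frac{q^{n^2} (-x)^n}{(q;q)_n} \;=\; (xq^2;q^2)_\infty \sum_{n\geq0} \frac{q^{n^2}(-x)^n}{(q^2,xq^2;q^2)_n}. \]
   Context: For $n\in\mathbb{Z}_{\ge 0}\cup\{\infty\}$, $(c;q)_n=\prod_{i=0}^{n-1}(1-cq^i)$ and $(c_1,\dots,c_r;q)_n=\prod_{j=1}^r (c_j;q)_n$. *)

theory Defs
  imports "HOL-Analysis.Analysis" "HOL-Computational_Algebra.Formal_Power_Series"
begin

definition qpoch :: "'a \<Rightarrow> 'a \<Rightarrow> nat \<Rightarrow> 'a :: comm_ring_1" where
  "qpoch c q n = (\<Prod>i<n. 1 - c * q ^ i)"

definition qpoch_inf :: "'a \<Rightarrow> 'a \<Rightarrow> 'a :: {t2_space, comm_ring_1}" where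
  "qpoch_inf c q = (\<Prod>i. 1 - c * q ^ i)"

text \<open>
  The formal variables: the power series ring in \<open>q\<close> over the power series ring in \<open>x\<close>
  over a field. Infinite sums and products are limits in the library topology of
  formal power series in the outer variable, i.e. the \<open>q\<close>-adic topology
  (the coefficient ring of power series in \<open>x\<close> is treated as discrete).
  Since the coefficient ring is not a field, the library quotient is not always an exact
  quotient; it is one for the denominators used, which have constant term 1 in \<open>q\<close>.
\<close>

abbreviation qvar :: "'a :: field fps fps" where
  "qvar \<equiv> fps_X"

abbreviation xvar :: "'a :: field fps fps" where
  "xvar \<equiv> fps_const fps_X"

lemma fps_fps_unit:
  fixes f g :: "'a :: field fps fps"
  assumes g: "fps_nth g 0 = 1"
  shows "f / g * g = f"
proof -
  have "subdegree g = 0" using g by (simp add: subdegree_eq_0_iff)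
  moreover have "g * inverse g = 1"
    unfolding fps_inverse_def[of g] by (rule fps_right_inverse) (simp add: g)
  ultimately show ?thesis by (simp add: fps_divide_unit' mult.assoc mult.commute[of _ g])
qed

end

theory Submission imports Defs begin

text \<open>
  Put \<open>p = q\<^sup>2\<close>. Absorbing the infinite product into the sum on the right-hand side turns it
  into \<open>\<Sum>n. q^(n\<^sup>2) (-x)^n (x p^(n+1); p)\<^sub>\<infinity> / (p; p)\<^sub>n\<close>. Expanding the products in powers of
  \<open>x\<close> reduces the claim to the Rogers--Szego evaluation
  \<open>\<Sum>m\<le>N. q^m / ((p; p)\<^sub>m (p; p)\<^sub>(N-m)) = 1 / (q; q)\<^sub>N\<close>. To avoid infinite double sums, everything is
  truncated at \<open>M\<close>: the infinite products become finite ones, which the \<open>q\<close>-binomial theorem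
  expands, and the resulting finite identity holds modulo \<open>q^M\<close>.
\<close>

section \<open>Finite q-Pochhammer symbols and Gaussian binomial coefficients\<close>

lemma qpoch_0 [simp]: "qpoch c q 0 = 1"
  by (simp add: qpoch_def)

lemma qpoch_Suc [simp]: "qpoch c q (Suc n) = qpoch c q n * (1 - c * q ^ n)"
  by (simp add: qpoch_def)

lemma qpoch_add: "qpoch c q (m + n) = qpoch c q m * qpoch (c * q ^ m) q n"
  by (induction n) (simp_all add: power_add mult.assoc)

text \<open>Each factor added beyond the first \<open>d\<close> has the form 1 - q^(d+m+1), so it
  changes the product only by a multiple of q^(d+1).\<close>

lemma qpoch_add_diff_dvd: "q ^ Suc d dvd qpoch q q (d + m) - qpoch q q d"
proof (induction m)
  case (Suc m)
  have "qpoch q q (d + Suc m) - qpoch q q d =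
      (qpoch q q (d + m) - qpoch q q d) - q ^ Suc d * (q ^ m * qpoch q q (d + m))"
    by (simp add: power_add algebra_simps)
  then show ?case using Suc by (metis dvd_diff dvd_triv_left)
qed simp

fun qbinom :: "'a :: comm_ring_1 \<Rightarrow> nat \<Rightarrow> nat \<Rightarrow> 'a" where
  "qbinom q k 0 = 1"
| "qbinom q 0 (Suc m) = 0"
| "qbinom q (Suc k) (Suc m) = qbinom q k (Suc m) + q ^ (k - m) * qbinom q k m"

lemma qbinom_eq_0: "k < m \<Longrightarrow> qbinom q k m = 0"
  by (induction q k m rule: qbinom.induct) auto

text \<open>The quotient formula, cleared of denominators. In the Pascal rule both terms reduce to
  (q;q)_k, and their weights combine through (1 - q^j) + q^j (1 - q^m) = 1 - q^(m+j).\<close>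

lemma qbinom_qpoch:
  "qbinom q (m + j) m * qpoch q q m * qpoch q q j = qpoch q q (m + j)"
proof (induction "m + j" arbitrary: m j)
  case (Suc k)
  show ?case
  proof (cases m)
    case (Suc m')
    show ?thesis
    proof (cases j)
      case 0
      have "qbinom q m' m' * qpoch q q m' = qpoch q q m'"
        using Suc.hyps(1)[of m' 0] Suc.hyps(2) Suc 0 by simp
      then show ?thesis using Suc 0 by (simp add: qbinom_eq_0 algebra_simps)
    next
      case (Suc j')
      have k: "k = Suc m' + j'" "k = m' + Suc j'" using Suc.hyps(2) \<open>m = Suc m'\<close> Suc by auto
      let ?a = "qpoch q q" and ?b = "qbinom q k"
      have 1: "?b (Suc m') * ?a (Suc m') * ?a j' = ?a k"
        using Suc.hyps(1)[OF k(1)] k(1) by simp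
      have 2: "?b m' * ?a m' * ?a (Suc j') = ?a k"
        using Suc.hyps(1)[OF k(2)] k(2) by simp
      have "qbinom q (Suc k) (Suc m') * ?a (Suc m') * ?a (Suc j') =
          (?b (Suc m') * ?a (Suc m') * ?a j') * (1 - q ^ Suc j') +
          q ^ Suc j' * (?b m' * ?a m' * ?a (Suc j')) * (1 - q ^ Suc m')"
        using k(2) by (simp add: algebra_simps)
      also have "\<dots> = ?a (Suc k)"
        unfolding 1 2 using k(2) by (simp add: algebra_simps power_add)
      finally show ?thesis using \<open>m = Suc m'\<close> Suc k by simp
    qed
  qed simp
qed simp

lemma Suc_choose_two: "Suc m choose 2 = (m choose 2) + m"
  by (simp add: numeral_2_eq_2)

text \<open>The Pascal rule splits the sum for k + 1 into the sum for k and a shifted sum. Since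
  (m+1 choose 2) + (k - m) = (m choose 2) + k, the latter is -z q^k times the former, which yields
  the new factor 1 - z q^k.\<close>

theorem q_binomial:
  "qpoch z q k = (\<Sum>m\<le>k. q ^ (m choose 2) * (- z) ^ m * qbinom q k m)"
proof (induction k)
  case (Suc k)
  let ?f = "\<lambda>m. q ^ (m choose 2) * (- z) ^ m"
  have "(\<Sum>m\<le>Suc k. ?f m * qbinom q (Suc k) m) =
      1 + (\<Sum>m\<le>k. ?f (Suc m) * qbinom q k (Suc m)) +
      (\<Sum>m\<le>k. ?f (Suc m) * (q ^ (k - m) * qbinom q k m))"
    by (simp only: sum.atMost_Suc_shift qbinom.simps distrib_left sum.distrib)
       (simp add: numeral_2_eq_2)
  also have "1 + (\<Sum>m\<le>k. ?f (Suc m) * qbinom q k (Suc m)) = (\<Sum>m\<le>Suc k. ?f m * qbinom q k m)"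
    by (simp add: sum.atMost_Suc_shift numeral_2_eq_2 del: sum.atMost_Suc)
  also have "\<dots> = (\<Sum>m\<le>k. ?f m * qbinom q k m)"
    by (simp add: qbinom_eq_0)
  also have "(\<Sum>m\<le>k. ?f (Suc m) * (q ^ (k - m) * qbinom q k m)) =
      (\<Sum>m\<le>k. - z * q ^ k * (?f m * qbinom q k m))"
  proof (rule sum.cong)
    fix m assume "m \<in> {..k}"
    then have "q ^ k = q ^ m * q ^ (k - m)" by (simp flip: power_add)
    then show "?f (Suc m) * (q ^ (k - m) * qbinom q k m) = - z * q ^ k * (?f m * qbinom q k m)"
      by (simp add: Suc_choose_two power_add algebra_simps)
  qed simp
  finally have "(\<Sum>m\<le>Suc k. ?f m * qbinom q (Suc k) m) =
      qpoch z q k + - z * q ^ k * qpoch z q k"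
    by (simp only: Suc sum_distrib_left)
  also have "\<dots> = qpoch z q (Suc k)" by (simp add: algebra_simps)
  finally show ?case ..
qed (simp add: numeral_2_eq_2)

section \<open>Reciprocals of (q^2; q^2)_n and the identity modulo q^M\<close>

context
  fixes q :: "'a :: comm_ring_1" and r :: "nat \<Rightarrow> 'a"
  assumes r: "\<And>n. r n * qpoch (q\<^sup>2) (q\<^sup>2) n = 1"
begin

lemma qpoch_recip_Suc: "r (Suc k) * (q\<^sup>2) ^ Suc k = r (Suc k) - r k"
proof -
  let ?a = "qpoch (q\<^sup>2) (q\<^sup>2)"
  have "r k = r k * (r (Suc k) * ?a (Suc k))" by (simp only: r) simp
  also have "\<dots> = (r k * ?a k) * (r (Suc k) * (1 - (q\<^sup>2) ^ Suc k))" by (simp add: algebra_simps)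
  finally show ?thesis by (simp add: r algebra_simps)
qed

text \<open>
  Writing \<open>h N\<close> for the sum, the \<open>h N\<close> are the coefficients of \<open>1 / ((t; q\<^sup>2)\<^sub>\<infinity> (t q; q\<^sup>2)\<^sub>\<infinity>) = 1 / (t; q)\<^sub>\<infinity>\<close>,
  whence the recurrence \<open>(1 - q^(N+1)) h (N+1) = h N\<close>.
\<close>

lemma rogers_szego_eval: "(\<Sum>m\<le>N. q ^ m * r m * r (N - m)) * qpoch q q N = 1"
proof (induction N)
  case 0
  show ?case using r[of 0] by simp
next
  case (Suc N)
  define h where "h = (\<lambda>N. \<Sum>m\<le>N. q ^ m * r m * r (N - m))"
  have "q ^ Suc N * h (Suc N) = (\<Sum>m\<le>Suc N. q ^ Suc N * (q ^ m * r m * r (Suc N - m)))"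
    unfolding h_def sum_distrib_left ..
  \<comment> \<open>After the reflection m -> N + 1 - m, the powers regroup as q^m (q^2)^(N+1-m),
    which \<open>qpoch_recip_Suc\<close> absorbs.\<close>
  also have "\<dots> = (\<Sum>m\<le>Suc N. q ^ Suc N * (q ^ (Suc N - m) * r (Suc N - m) * r m))"
    by (rule sum.reindex_bij_witness[where i = "\<lambda>m. Suc N - m" and j = "\<lambda>m. Suc N - m"]) auto
  also have "\<dots> = (\<Sum>m\<le>Suc N. q ^ m * r m * (r (Suc N - m) * (q\<^sup>2) ^ (Suc N - m)))"
  proof (rule sum.cong)
    fix m assume "m \<in> {..Suc N}"
    then have "q ^ Suc N = q ^ m * q ^ (Suc N - m)" by (simp flip: power_add)
    then show "q ^ Suc N * (q ^ (Suc N - m) * r (Suc N - m) * r m) =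
        q ^ m * r m * (r (Suc N - m) * (q\<^sup>2) ^ (Suc N - m))"
      by (simp add: power2_eq_square power_mult_distrib algebra_simps del: power_Suc)
  qed simp
  \<comment> \<open>The term m = N + 1 is split off: it belongs to h (N+1) but has no counterpart in
    h N.\<close>
  also have "\<dots> = (\<Sum>m\<le>N. q ^ m * r m * (r (Suc N - m) * (q\<^sup>2) ^ (Suc N - m))) + q ^ Suc N * r (Suc N) * r 0"
    by simp
  also have "(\<Sum>m\<le>N. q ^ m * r m * (r (Suc N - m) * (q\<^sup>2) ^ (Suc N - m))) =
      (\<Sum>m\<le>N. q ^ m * r m * (r (Suc N - m) - r (N - m)))"
    by (rule sum.cong) (simp_all add: Suc_diff_le qpoch_recip_Suc del: power_Suc)
  also have "\<dots> + q ^ Suc N * r (Suc N) * r 0 = h (Suc N) - h N"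
    unfolding h_def by (simp add: right_diff_distrib sum_subtractf)
  finally have "h (Suc N) * (1 - q ^ Suc N) = h N" by (simp add: algebra_simps)
  moreover have "h (Suc N) * qpoch q q (Suc N) = h (Suc N) * (1 - q ^ Suc N) * qpoch q q N"
    by (simp add: mult_ac)
  ultimately show ?case using Suc unfolding h_def by (simp only:)
qed

text \<open>A quantitative form of the limit of Gaussian binomials: with p = q^2, the coefficient of
  m + d over m tends to 1 / (p; p)_m as d grows. The error is a multiple of (p; p)_(d+m) - (p;
  p)_d.\<close>

lemma qbinom_recip_dvd:
  "(q\<^sup>2) ^ Suc d dvd qbinom (q\<^sup>2) (m + d) m - r m"
proof -
  let ?a = "qpoch (q\<^sup>2) (q\<^sup>2)" and ?b = "qbinom (q\<^sup>2) (m + d) m"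
  have "?b - r m = (r m * ?a m) * (r d * ?a d) * ?b - r m * (r d * ?a d)" by (simp add: r)
  also have "\<dots> = r m * r d * (?b * ?a m * ?a d - ?a d)" by (simp add: algebra_simps)
  also have "\<dots> = r m * r d * (?a (d + m) - ?a d)" by (simp add: qbinom_qpoch add.commute[of d])
  finally show ?thesis using qpoch_add_diff_dvd[of "q\<^sup>2" d m] by (metis dvd_mult)
qed

text \<open>The factor \<open>s n\<close> cancels the first n factors of the product, and
  \<open>q_binomial\<close> expands the other M - n. Both sides become sums over m + n \<le> M with
  equal coefficients, one carrying a Gaussian binomial and the other its limit
  \<open>r m\<close>.\<close>

lemma truncated_identity_dvd:
  assumes s: "\<And>n. s n * qpoch (x * q\<^sup>2) (q\<^sup>2) n = 1"
  assumes t: "\<And>n. t n * qpoch q q n = 1"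
  shows "q ^ M dvd qpoch (x * q\<^sup>2) (q\<^sup>2) M * (\<Sum>n\<le>M. q ^ (n\<^sup>2) * (- x) ^ n * (r n * s n))
    - (\<Sum>n\<le>M. q ^ (n\<^sup>2) * (- x) ^ n * t n)"
proof -
  let ?p = "q\<^sup>2"
  let ?I = "{(m, n). m + n \<le> M}"
  let ?c = "\<lambda>m n. q ^ ((m + n)\<^sup>2 + m) * (- x) ^ (m + n) * r n"
  have "qpoch (x * ?p) ?p M * (\<Sum>n\<le>M. q ^ (n\<^sup>2) * (- x) ^ n * (r n * s n)) =
      (\<Sum>n\<le>M. \<Sum>m\<le>M - n. ?c m n * qbinom ?p (M - n) m)"
    unfolding sum_distrib_left
  proof (rule sum.cong)
    fix n assume "n \<in> {..M}"
    then have "qpoch (x * ?p) ?p M = qpoch (x * ?p) ?p n * qpoch (x * ?p * ?p ^ n) ?p (M - n)"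
      by (simp flip: qpoch_add)
    then have "qpoch (x * ?p) ?p M * (q ^ (n\<^sup>2) * (- x) ^ n * (r n * s n)) =
        (s n * qpoch (x * ?p) ?p n) * (q ^ (n\<^sup>2) * (- x) ^ n * r n * qpoch (x * ?p * ?p ^ n) ?p (M - n))"
      by (simp add: algebra_simps)
    also have "\<dots> = (\<Sum>m\<le>M - n. q ^ (n\<^sup>2) * (- x) ^ n * r n *
        (?p ^ (m choose 2) * (- (x * ?p * ?p ^ n)) ^ m * qbinom ?p (M - n) m))"
      by (simp only: s mult_1_left q_binomial[of "x * ?p * ?p ^ n"] sum_distrib_left)
    also have "\<dots> = (\<Sum>m\<le>M - n. ?c m n * qbinom ?p (M - n) m)"
    proof (rule sum.cong)
      fix m
      \<comment> \<open>The exponents of q from the expansion complete the square n^2 to (m + n)^2,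
        leaving the extra m needed for the Rogers-Szego sum.\<close>
      have "2 * (m choose 2) + m = m\<^sup>2"
        by (induction m) (simp_all add: Suc_choose_two power2_eq_square)
      then have e: "(m + n)\<^sup>2 + m = n\<^sup>2 + (2 * (m choose 2) + (2 + 2 * n) * m)"
        by (simp add: power2_eq_square algebra_simps)
      have "q ^ ((m + n)\<^sup>2 + m) = q ^ (n\<^sup>2) * (?p ^ (m choose 2) * (?p * ?p ^ n) ^ m)"
        unfolding e by (simp only: power_add power_mult)
      moreover have "(- (x * ?p * ?p ^ n)) ^ m = (- x) ^ m * (?p * ?p ^ n) ^ m"
        by (simp add: mult.assoc flip: power_mult_distrib)
      ultimately show "q ^ (n\<^sup>2) * (- x) ^ n * r n *
          (?p ^ (m choose 2) * (- (x * ?p * ?p ^ n)) ^ m * qbinom ?p (M - n) m) =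
          ?c m n * qbinom ?p (M - n) m"
        by (simp add: power_add mult_ac)
    qed simp
    finally show "qpoch (x * ?p) ?p M * (q ^ (n\<^sup>2) * (- x) ^ n * (r n * s n)) =
        (\<Sum>m\<le>M - n. ?c m n * qbinom ?p (M - n) m)" .
  qed simp
  also have "\<dots> = (\<Sum>(n, m)\<in>(SIGMA n:{..M}. {..M - n}). ?c m n * qbinom ?p (M - n) m)"
    by (rule sum.Sigma) auto
  also have "\<dots> = (\<Sum>(m, n)\<in>?I. ?c m n * qbinom ?p (M - n) m)"
    by (rule sum.reindex_bij_witness[where i = prod.swap and j = prod.swap]) auto
  finally have 1: "qpoch (x * ?p) ?p M * (\<Sum>n\<le>M. q ^ (n\<^sup>2) * (- x) ^ n * (r n * s n)) =
      (\<Sum>(m, n)\<in>?I. ?c m n * qbinom ?p (M - n) m)" .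
  \<comment> \<open>Uniqueness of inverses identifies \<open>t N\<close> with the Rogers-Szego
    sum.\<close>
  have t_eq: "t N = (\<Sum>m\<le>N. q ^ m * r m * r (N - m))" for N
  proof -
    let ?h = "\<Sum>m\<le>N. q ^ m * r m * r (N - m)"
    have "t N = t N * (?h * qpoch q q N)" by (simp only: rogers_szego_eval mult_1_right)
    also have "\<dots> = ?h * (t N * qpoch q q N)" by (simp only: mult_ac)
    finally show ?thesis by (simp only: t mult_1_right)
  qed
  have "(\<Sum>N\<le>M. q ^ (N\<^sup>2) * (- x) ^ N * t N) = (\<Sum>N\<le>M. \<Sum>m\<le>N. ?c m (N - m) * r m)"
    unfolding t_eq sum_distrib_left by (intro sum.cong) (auto simp: power_add mult_ac)
  also have "\<dots> = (\<Sum>(m, n)\<in>?I. ?c m n * r m)"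
    by (rule sum.triangle_reindex_eq[symmetric])
  finally have 2: "(\<Sum>N\<le>M. q ^ (N\<^sup>2) * (- x) ^ N * t N) = (\<Sum>(m, n)\<in>?I. ?c m n * r m)" .
  have dvd: "q ^ M dvd ?c m n * (qbinom ?p (M - n) m - r m)" if "m + n \<le> M" for m n
  proof -
    define d where "d = M - n - m"
    have d: "M - n = m + d" "M = m + n + d" using that by (auto simp: d_def)
    have "q ^ ((m + n)\<^sup>2 + m) * ?p ^ Suc d dvd ?c m n * (qbinom ?p (M - n) m - r m)"
      unfolding d(1) mult.assoc by (intro mult_dvd_mono dvd_mult qbinom_recip_dvd) auto
    \<comment> \<open>Here M = m + n + d and (m + n)^2 \<ge> m + n, so the power of q in
      \<open>?c\<close> makes up for the part of M that the error bound misses.\<close>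
    moreover have "M \<le> (m + n)\<^sup>2 + m + 2 * Suc d"
      using d(2) self_le_power[of "m + n" 2] by (cases "m + n = 0") auto
    then have "q ^ M dvd q ^ ((m + n)\<^sup>2 + m) * ?p ^ Suc d"
      by (simp only: le_imp_power_dvd flip: power_add power_mult)
    ultimately show ?thesis by (rule dvd_trans[rotated])
  qed
  show ?thesis
    unfolding 1 2 sum_subtractf[symmetric]
  proof (rule dvd_sum)
    fix z assume "z \<in> ?I"
    then obtain m n where z: "z = (m, n)" and mn: "m + n \<le> M" by blast
    from dvd[OF mn]
    show "q ^ M dvd (case z of (m, n) \<Rightarrow> ?c m n * qbinom ?p (M - n) m) -
        (case z of (m, n) \<Rightarrow> ?c m n * r m)"
      unfolding z prod.case right_diff_distrib .
  qed
qed

end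

section \<open>Convergence of formal power series\<close>

lemma fps_X_power_dvd_imp_nth_eq:
  fixes f g :: "'a :: comm_ring_1 fps"
  assumes "fps_X ^ n dvd f - g" "k < n"
  shows "fps_nth f k = fps_nth g k"
proof -
  from assms(1) obtain h where "f - g = fps_X ^ n * h" ..
  then have "fps_nth (f - g) k = 0" using assms(2) by (simp add: fps_X_power_mult_nth)
  then show ?thesis by simp
qed

text \<open>Coefficient n no longer changes from index n on, so the diagonal collects the limiting
  coefficients.\<close>

lemma fps_tendsto_Abs_fps_diagonal:
  fixes F :: "nat \<Rightarrow> 'a :: comm_ring_1 fps"
  assumes "\<And>n. fps_X ^ Suc n dvd F (Suc n) - F n"
  shows "F \<longlonglongrightarrow> Abs_fps (\<lambda>n. fps_nth (F n) n)"
proof (rule tendsto_fpsI)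
  fix n
  have "fps_nth (F m) n = fps_nth (F n) n" if "n \<le> m" for m
    using that
  proof (induction m rule: dec_induct)
    case (step m)
    with fps_X_power_dvd_imp_nth_eq[OF assms[of m], of n] show ?case by simp
  qed simp
  then show "eventually (\<lambda>m. fps_nth (F m) n = fps_nth (Abs_fps (\<lambda>n. fps_nth (F n) n)) n) sequentially"
    unfolding fps_nth_Abs_fps by (rule eventually_sequentiallyI)
qed

lemma fps_summable_power_square:
  fixes f :: "nat \<Rightarrow> 'a :: comm_ring_1 fps"
  shows "summable (\<lambda>n. fps_X ^ (n\<^sup>2) * f n)"
proof -
  let ?F = "\<lambda>n. \<Sum>i\<le>n. fps_X ^ (i\<^sup>2) * f i"
  have "fps_X ^ Suc n dvd ?F (Suc n) - ?F n" for n
  proof -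
    have "(fps_X :: 'a fps) ^ Suc n dvd fps_X ^ (Suc n)\<^sup>2"
      by (rule le_imp_power_dvd) (simp add: power2_eq_square)
    moreover have "?F (Suc n) - ?F n = fps_X ^ (Suc n)\<^sup>2 * f (Suc n)" by simp
    ultimately show ?thesis by (simp only: dvd_mult2)
  qed
  from fps_tendsto_Abs_fps_diagonal[of ?F, OF this] show ?thesis
    unfolding summable_def sums_def_le by (rule exI)
qed

lemma fps_has_prod:
  fixes f :: "nat \<Rightarrow> 'a :: comm_ring_1 fps"
  assumes "\<And>n. fps_X ^ Suc n dvd f n - 1"
  obtains P where "raw_has_prod f 0 P"
proof -
  let ?F = "\<lambda>n. \<Prod>i\<le>n. f i"
  have "fps_X ^ Suc n dvd ?F (Suc n) - ?F n" for n
  proof -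
    have "?F (Suc n) - ?F n = ?F n * (f (Suc n) - 1)" by (simp add: algebra_simps)
    moreover have "fps_X ^ Suc n dvd f (Suc n) - 1" by (rule power_le_dvd[OF assms]) simp
    ultimately show ?thesis by (simp only: dvd_mult)
  qed
  from fps_tendsto_Abs_fps_diagonal[of ?F, OF this]
  have "?F \<longlonglongrightarrow> Abs_fps (\<lambda>n. fps_nth (?F n) n)" .
  \<comment> \<open>\<open>raw_has_prod\<close> demands a nonzero limit; the constant coefficient 1
    guarantees it.\<close>
  moreover have "fps_nth (f 0) 0 = 1"
    using fps_X_power_dvd_imp_nth_eq[OF assms[of 0], of 0] by simp
  then have "Abs_fps (\<lambda>n. fps_nth (?F n) n) \<noteq> 0"
    by (intro fps_nonzeroI[of _ 0]) simp
  ultimately show ?thesis by (intro that) (simp add: raw_has_prod_def)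
qed

text \<open>Coefficient n of a product involves only finitely many coefficients of the factors, each
  eventually constant.\<close>

lemma tendsto_mult_fps:
  fixes f g :: "'b \<Rightarrow> 'a :: comm_ring_1 fps"
  assumes "(f \<longlongrightarrow> a) F" "(g \<longlongrightarrow> b) F"
  shows "((\<lambda>x. f x * g x) \<longlongrightarrow> a * b) F"
proof (rule tendsto_fpsI)
  fix n
  have "eventually (\<lambda>x. \<forall>k\<in>{..n}. fps_nth (f x) k = fps_nth a k \<and> fps_nth (g x) k = fps_nth b k) F"
    using assms by (intro eventually_ball_finite) (auto simp: tendsto_fps_iff intro: eventually_conj)
  then show "eventually (\<lambda>x. fps_nth (f x * g x) n = fps_nth (a * b) n) F"
    by eventually_elim (simp add: fps_mult_nth)
qed

lemma fps_tendsto_of_dvd_diff: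
  fixes f g :: "nat \<Rightarrow> 'a :: comm_ring_1 fps"
  assumes "f \<longlonglongrightarrow> a" "\<And>n. fps_X ^ n dvd f n - g n"
  shows "g \<longlonglongrightarrow> a"
proof (rule tendsto_fpsI)
  fix k
  have "eventually (\<lambda>n. fps_nth (f n) k = fps_nth a k) sequentially"
    using assms(1) by (simp add: tendsto_fps_iff)
  then show "eventually (\<lambda>n. fps_nth (g n) k = fps_nth a k) sequentially"
    using eventually_gt_at_top[of k]
    by eventually_elim (use fps_X_power_dvd_imp_nth_eq[OF assms(2)] in metis)
qed

section \<open>Exact quotients and the passage to the limit\<close>

lemma fps_nth_qpoch_0:
  fixes c q :: "'a :: comm_ring_1 fps"
  assumes "fps_nth c 0 = 0"
  shows "fps_nth (qpoch c q n) 0 = 1"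
  using assms by (induction n) simp_all

text \<open>Replaces the library quotient by multiplication with an explicit inverse, so that the
  ring identities above apply.\<close>

lemma fps_fps_divide_eq_mult:
  fixes f g :: "'a :: field fps fps"
  assumes "g * h = 1" "fps_nth g 0 = 1"
  shows "f / g = f * h"
  by (metis assms fps_fps_unit mult.assoc mult.right_neutral)

theorem theorem2:
  fixes q x :: "'a :: field fps fps"
  assumes q: "q = qvar" and x: "x = xvar"
  shows "summable (\<lambda>n. q ^ (n\<^sup>2) * (- x) ^ n / qpoch q q n) \<and>
    convergent_prod (\<lambda>i. 1 - (x * q\<^sup>2) * (q\<^sup>2) ^ i) \<and>
    summable (\<lambda>n. q ^ (n\<^sup>2) * (- x) ^ n / (qpoch (q\<^sup>2) (q\<^sup>2) n * qpoch (x * q\<^sup>2) (q\<^sup>2) n)) \<and>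
    (\<Sum>n. q ^ (n\<^sup>2) * (- x) ^ n / qpoch q q n) =
      qpoch_inf (x * q\<^sup>2) (q\<^sup>2) *
      (\<Sum>n. q ^ (n\<^sup>2) * (- x) ^ n / (qpoch (q\<^sup>2) (q\<^sup>2) n * qpoch (x * q\<^sup>2) (q\<^sup>2) n))"
proof -
  define r where "r n = 1 / qpoch (q\<^sup>2) (q\<^sup>2) n" for n
  define s where "s n = 1 / qpoch (x * q\<^sup>2) (q\<^sup>2) n" for n
  define t where "t n = 1 / qpoch q q n" for n
  have u: "fps_nth (qpoch (q\<^sup>2) (q\<^sup>2) n) 0 = 1" "fps_nth (qpoch (x * q\<^sup>2) (q\<^sup>2) n) 0 = 1"
      "fps_nth (qpoch q q n) 0 = 1" for n
    using q by (auto intro!: fps_nth_qpoch_0 simp: power2_eq_square)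
  have r: "r n * qpoch (q\<^sup>2) (q\<^sup>2) n = 1" and s: "s n * qpoch (x * q\<^sup>2) (q\<^sup>2) n = 1"
    and t: "t n * qpoch q q n = 1" for n
    unfolding r_def s_def t_def by (intro fps_fps_unit u)+
  define a where "a n = q ^ (n\<^sup>2) * (- x) ^ n * t n" for n
  define b where "b n = q ^ (n\<^sup>2) * (- x) ^ n * (r n * s n)" for n
  have a_eq: "q ^ (n\<^sup>2) * (- x) ^ n / qpoch q q n = a n" for n
    unfolding a_def using t[of n] by (intro fps_fps_divide_eq_mult) (simp_all add: u mult.commute)
  have b_eq: "q ^ (n\<^sup>2) * (- x) ^ n / (qpoch (q\<^sup>2) (q\<^sup>2) n * qpoch (x * q\<^sup>2) (q\<^sup>2) n) = b n" for n
  proof -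
    have "qpoch (q\<^sup>2) (q\<^sup>2) n * qpoch (x * q\<^sup>2) (q\<^sup>2) n * (r n * s n) =
        (r n * qpoch (q\<^sup>2) (q\<^sup>2) n) * (s n * qpoch (x * q\<^sup>2) (q\<^sup>2) n)"
      by (simp only: mult_ac)
    then show ?thesis
      unfolding b_def by (intro fps_fps_divide_eq_mult) (simp_all add: u r s)
  qed
  have a: "summable a" and b: "summable b"
    unfolding a_def b_def q mult.assoc by (rule fps_summable_power_square)+
  let ?f = "\<lambda>i. 1 - (x * q\<^sup>2) * (q\<^sup>2) ^ i"
  have "fps_X ^ Suc i dvd ?f i - 1" for i
  proof -
    have "?f i - 1 = q ^ Suc i * (- x * q * q ^ i)"
      by (simp add: power2_eq_square power_mult_distrib algebra_simps)
    then show ?thesis unfolding q by (simp only: dvd_triv_left)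
  qed
  then obtain P where P: "raw_has_prod ?f 0 P" by (rule fps_has_prod)
  then have "?f has_prod P" by (simp add: has_prod_def)
  then have P_eq: "qpoch_inf (x * q\<^sup>2) (q\<^sup>2) = P"
    unfolding qpoch_inf_def by (rule has_prod_unique[symmetric])
  have "(\<lambda>M. qpoch (x * q\<^sup>2) (q\<^sup>2) M) \<longlonglongrightarrow> P"
    using P LIMSEQ_lessThan_iff_atMost[of "\<lambda>A. \<Prod>i\<in>A. ?f i"]
    by (simp add: raw_has_prod_def qpoch_def)
  then have "(\<lambda>M. qpoch (x * q\<^sup>2) (q\<^sup>2) M * (\<Sum>n\<le>M. b n)) \<longlonglongrightarrow> P * suminf b"
    using summable_LIMSEQ'[OF b] by (rule tendsto_mult_fps)
  \<comment> \<open>The truncations of the two sides agree modulo q^M, so they share their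
    limit.\<close>
  then have "(\<lambda>M. \<Sum>n\<le>M. a n) \<longlonglongrightarrow> P * suminf b"
    by (rule fps_tendsto_of_dvd_diff)
       (use truncated_identity_dvd[OF r s t] in \<open>simp add: a_def b_def q\<close>)
  with summable_LIMSEQ'[OF a] have "suminf a = P * suminf b" by (rule LIMSEQ_unique)
  with a b P show ?thesis
    unfolding a_eq b_eq P_eq convergent_prod_def by blast
qed

end
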